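(* Let $d\ge 1$. The polynomials $\{T_b : b\in\tilde{B}_3\}$ (indexed by the bracelets $b \in \tilde B_3$) are linearly independent over $\mathbb{C}$.
   Context: Let $A_0=\begin{pmatrix} a_1 & a_2 \\ a_3 & a_4\end{pmatrix}$ and $A_1=\begin{pmatrix} b_1 & b_2 \\ b_3 & b_4\end{pmatrix}$ be generic $2\times 2$ matrices whose entries are the eight variables of the polynomial ring $\mathbb{C}[a_1,\dots,a_4,b_1,\dots,b_4]$. For a binary word $i_1\cdots i_d$ with $i_j\in\{0,1\}$, put $T_{i_1\cdots i_d}:=\operatorname{Tr}(A_{i_1}\cdots A_{i_d})\in\mathbb{C}[a_1,\dots,b_4]$. A binary bracelet of length $d$ is an equivalence class of words in $\{0,1\}^d$ under the dihedral group generated by cyclic rotation and reversal of words. For $2\times2$ matrices $T_{i_1\cdots i_d}$ is invariant under rotation and reversal of the word, so $T_b$ is well defined for a bracelet $b$. $B_3(2,d)$ denotes the set of binary bracelets of length $d$ of weight $3$, meaning that they contain exactly three letters equal to $1$. The subset $\tilde{B}_3\subset B_3(2,d)$ is $$\tilde{B}_3:=\{b\in B_3(2,d) : b \text{ contains } 11 \text{ or } 101\},$$ where "$b$ contains $u$" means that some word representing $b$ contains $u$ as a string of consecutive letters. *)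

theory Defs
  imports "HOL-Analysis.Analysis" "HOL-Library.Poly_Mapping" "HOL-Library.Sublist"
begin

section \<open>The polynomial ring in eight variables over the complex numbers\<close>

datatype var = VA1 | VA2 | VA3 | VA4 | VB1 | VB2 | VB3 | VB4

text \<open>A monomial is a finitely supported exponent function and a polynomial is a finitely
  supported coefficient function on monomials; the ring operations are the convolution
  ones provided by \<open>Poly_Mapping\<close>.\<close>

type_synonym mpoly = "(var \<Rightarrow>\<^sub>0 nat) \<Rightarrow>\<^sub>0 complex"

definition Var :: "var \<Rightarrow> mpoly" where
  "Var v = Poly_Mapping.single (Poly_Mapping.single v 1) 1"

definition mpoly_scale :: "complex \<Rightarrow> mpoly \<Rightarrow> mpoly" where
  "mpoly_scale c p = Poly_Mapping.map ((*) c) p"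

lemma lookup_mpoly_scale:
  "Poly_Mapping.lookup (mpoly_scale c p) m = c * Poly_Mapping.lookup p m"
  by (simp add: mpoly_scale_def Poly_Mapping.map.rep_eq when_def)

lemma mpoly_scale_eq: "mpoly_scale c p = Poly_Mapping.single 0 c * p"
  unfolding mpoly_scale_def by (rule mult_map_scale_conv_mult)

global_interpretation mpoly: vector_space mpoly_scale
  by unfold_locales
    (simp_all add: mpoly_scale_eq distrib_left distrib_right single_add mult_single flip: mult.assoc)


section \<open>Traces of words in two generic matrices\<close>

definition A0 :: "mpoly^2^2" where
  "A0 = vector [vector [Var VA1, Var VA2], vector [Var VA3, Var VA4]]"

definition A1 :: "mpoly^2^2" where
  "A1 = vector [vector [Var VB1, Var VB2], vector [Var VB3, Var VB4]]"

text \<open>Binary words are lists of booleans; \<open>True\<close> is the letter 1, \<open>False\<close> the letter 0.\<close>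

definition letter_mat :: "bool \<Rightarrow> mpoly^2^2" where
  "letter_mat i = (if i then A1 else A0)"

definition word_mat :: "bool list \<Rightarrow> mpoly^2^2" where
  "word_mat w = foldr (\<lambda>i M. letter_mat i ** M) w (mat 1)"

definition T_word :: "bool list \<Rightarrow> mpoly" where
  "T_word w = trace (word_mat w)"


section \<open>Bracelets\<close>

text \<open>\<open>dihedral_eq u v\<close>: \<open>v\<close> is obtained from \<open>u\<close> by finitely many rotations and reversals.
  As both have finite order on words of a given length, closing under the generators alone
  gives the orbits of the group (\<open>dihedral_eq_sym\<close>).\<close>

inductive dihedral_eq :: "bool list \<Rightarrow> bool list \<Rightarrow> bool" where
  refl: "dihedral_eq u u"
| rotate: "dihedral_eq u v \<Longrightarrow> dihedral_eq u (rotate1 v)"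
| reverse: "dihedral_eq u v \<Longrightarrow> dihedral_eq u (rev v)"

definition words :: "nat \<Rightarrow> bool list set" where
  "words d = {w. length w = d}"

definition bracelets :: "nat \<Rightarrow> bool list set set" where
  "bracelets d = words d // {(u, v). u \<in> words d \<and> v \<in> words d \<and> dihedral_eq u v}"

definition bracelets_of_weight :: "nat \<Rightarrow> nat \<Rightarrow> bool list set set" where
  "bracelets_of_weight k d = {b \<in> bracelets d. \<forall>w\<in>b. count_list w True = k}"

definition bracelet_contains :: "bool list set \<Rightarrow> bool list \<Rightarrow> bool" where
  "bracelet_contains b u \<longleftrightarrow> (\<exists>w\<in>b. sublist u w)"

definition B3_tilde :: "nat \<Rightarrow> bool list set set" where
  "B3_tilde d = {b \<in> bracelets_of_weight 3 d.
     bracelet_contains b [True, True] \<or> bracelet_contains b [True, False, True]}"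

text \<open>The common value of \<open>T_word\<close> on a bracelet; it is well defined by \<open>T_bracelet_eq\<close> below.\<close>

definition T_bracelet :: "bool list set \<Rightarrow> mpoly" where
  "T_bracelet b = the_elem (T_word ` b)"


subsection \<open>The definitions make sense\<close>

lemma dihedral_eq_trans: "dihedral_eq v w \<Longrightarrow> dihedral_eq u v \<Longrightarrow> dihedral_eq u w"
  by (induction rule: dihedral_eq.induct) (auto intro: dihedral_eq.intros)

lemma dihedral_eq_length: "dihedral_eq u v \<Longrightarrow> length v = length u"
  by (induction rule: dihedral_eq.induct) auto

lemma dihedral_eq_count: "dihedral_eq u v \<Longrightarrow> count_list v x = count_list u x"
proof (induction rule: dihedral_eq.induct)
  case (rotate u v)
  then show ?case by (cases v) auto
qed auto

lemma dihedral_eq_rotate: "dihedral_eq u (rotate n u)"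
  by (induction n) (auto intro: dihedral_eq.intros)

lemma dihedral_eq_sym: "dihedral_eq u v \<Longrightarrow> dihedral_eq v u"
proof (induction rule: dihedral_eq.induct)
  case (refl u)
  show ?case by (rule dihedral_eq.refl)
next
  case (rotate u v)
  have "dihedral_eq (rotate1 v) v"
  proof (cases v)
    case Nil
    then show ?thesis by (simp add: dihedral_eq.refl)
  next
    case (Cons x xs)
    have "rotate (length xs) (rotate1 v) = rotate (length v) v"
      using Cons by (simp add: rotate1_rotate_swap)
    then show ?thesis
      using dihedral_eq_rotate[of "rotate1 v" "length xs"] by simp
  qed
  with rotate.IH show ?case using dihedral_eq_trans by blast
next
  case (reverse u v)
  have "dihedral_eq (rev v) v"
    using dihedral_eq.reverse[OF dihedral_eq.refl, of "rev v"] by simp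
  with reverse.IH show ?case using dihedral_eq_trans by blast
qed

lemma equiv_dihedral:
  "equiv (words d) {(u, v). u \<in> words d \<and> v \<in> words d \<and> dihedral_eq u v}"
proof (rule equivI)
  show "refl_on (words d) {(u, v). u \<in> words d \<and> v \<in> words d \<and> dihedral_eq u v}"
    by (simp add: refl_on_def dihedral_eq.refl)
  show "sym {(u, v). u \<in> words d \<and> v \<in> words d \<and> dihedral_eq u v}"
    using dihedral_eq_sym by (auto simp: sym_def)
  show "trans {(u, v). u \<in> words d \<and> v \<in> words d \<and> dihedral_eq u v}"
    using dihedral_eq_trans unfolding trans_def by blast
qed auto

lemma word_mat_simps [simp]:
  "word_mat [] = mat 1"
  "word_mat (i # w) = letter_mat i ** word_mat w"
  by (simp_all add: word_mat_def)

lemma word_mat_append: "word_mat (u @ v) = word_mat u ** word_mat v"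
  by (induction u) (auto simp: matrix_mul_assoc)

lemma T_word_rotate1: "T_word (rotate1 w) = T_word w"
proof (cases w)
  case (Cons x xs)
  then show ?thesis
    by (simp add: T_word_def word_mat_append trace_mul_sym[of "letter_mat x"])
qed simp

text \<open>Invariance under reversal: by the Cayley-Hamilton theorem every word is a combination
  of \<open>1\<close>, \<open>A0\<close>, \<open>A1\<close>, \<open>A0 A1\<close>, and its reversal is the same combination of
  \<open>1\<close>, \<open>A0\<close>, \<open>A1\<close>, \<open>A1 A0\<close>.\<close>

definition word_comb ::
    "'a::comm_ring_1^2^2 \<Rightarrow> 'a^2^2 \<Rightarrow> 'a \<Rightarrow> 'a \<Rightarrow> 'a \<Rightarrow> 'a \<Rightarrow> 'a^2^2 \<Rightarrow> 'a^2^2" where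
  "word_comb A B p q r s C = (\<chi> i j. p * mat 1 $ i $ j + q * A $ i $ j + r * B $ i $ j + s * C $ i $ j)"

lemma word_comb_A0:
  fixes A B :: "'a::comm_ring_1^2^2"
  defines "t \<equiv> trace A" and "n \<equiv> det A"
  shows "A ** word_comb A B p q r s (A ** B) = word_comb A B (- q * n) (p + q * t) (- s * n) (r + s * t) (A ** B)"
    and "word_comb A B p q r s (B ** A) ** A = word_comb A B (- q * n) (p + q * t) (- s * n) (r + s * t) (B ** A)"
  unfolding t_def n_def word_comb_def
  by (simp_all add: vec_eq_iff matrix_matrix_mult_def sum_2 forall_2 mat_def trace_def det_2)
     (simp_all add: algebra_simps)

lemma word_comb_A1:
  fixes A B :: "'a::comm_ring_1^2^2"
  defines "t \<equiv> trace A" and "u \<equiv> trace B" and "m \<equiv> det B"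
    and "e \<equiv> trace (A ** B) - trace A * trace B"
  shows "B ** word_comb A B p q r s (A ** B)
    = word_comb A B (q * e - r * m - s * t * m) (q * u + s * m) (p + q * t + r * u + s * (e + t * u)) (- q) (A ** B)"
    and "word_comb A B p q r s (B ** A) ** B
    = word_comb A B (q * e - r * m - s * t * m) (q * u + s * m) (p + q * t + r * u + s * (e + t * u)) (- q) (B ** A)"
  unfolding t_def u_def m_def e_def word_comb_def
  by (simp_all add: vec_eq_iff matrix_matrix_mult_def sum_2 forall_2 mat_def trace_def det_2)
     (simp_all add: algebra_simps)
lemma word_mat_comb:
  "\<exists>p q r s. word_mat w = word_comb A0 A1 p q r s (A0 ** A1) \<and> word_mat (rev w) = word_comb A0 A1 p q r s (A1 ** A0)"
proof (induction w)
  case Nil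
  have "mat 1 = word_comb A0 A1 1 0 0 0 C" for C
    by (simp add: word_comb_def vec_eq_iff)
  then show ?case by (simp only: word_mat_simps rev.simps) blast
next
  case (Cons x w)
  then obtain p q r s where w: "word_mat w = word_comb A0 A1 p q r s (A0 ** A1)"
      "word_mat (rev w) = word_comb A0 A1 p q r s (A1 ** A0)" by blast
  show ?case
  proof (cases x)
    case True
    then show ?thesis
      using word_comb_A1[where A=A0 and B=A1 and p=p and q=q and r=r and s=s] by (simp add: w word_mat_append letter_mat_def) blast
  next
    case False
    then show ?thesis
      using word_comb_A0[where A=A0 and B=A1 and p=p and q=q and r=r and s=s] by (simp add: w word_mat_append letter_mat_def) blast
  qed
qed

lemma T_word_rev: "T_word (rev w) = T_word w"
proof -
  obtain p q r s where w: "word_mat w = word_comb A0 A1 p q r s (A0 ** A1)"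
      "word_mat (rev w) = word_comb A0 A1 p q r s (A1 ** A0)"
    using word_mat_comb by blast
  have "trace (word_comb A0 A1 p q r s C) = p * 2 + q * trace A0 + r * trace A1 + s * trace C" for C
    by (simp add: word_comb_def trace_def sum_2 mat_def algebra_simps)
  then show ?thesis
    using trace_mul_sym[of A0 A1] by (simp add: T_word_def w)
qed

lemma T_word_dihedral: "dihedral_eq u v \<Longrightarrow> T_word v = T_word u"
  by (induction rule: dihedral_eq.induct) (auto simp: T_word_rotate1 T_word_rev)

lemma T_bracelet_eq:
  assumes "b \<in> bracelets d" "w \<in> b"
  shows "T_bracelet b = T_word w"
proof -
  have "T_word v = T_word w" if "v \<in> b" for v
  proof -
    have "(w, v) \<in> {(u, v). u \<in> words d \<and> v \<in> words d \<and> dihedral_eq u v}"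
      using quotient_eq_iff[OF equiv_dihedral assms(1)[unfolded bracelets_def]
          assms(1)[unfolded bracelets_def] assms(2) that] by (rule iffD1) (rule HOL.refl)
    then have "dihedral_eq w v" by simp
    then show ?thesis by (rule T_word_dihedral)
  qed
  then have "T_word ` b = {T_word w}"
    using assms(2) by blast
  then show ?thesis
    by (simp add: T_bracelet_def)
qed

end

theory Submission
  imports Defs
begin

text \<open>A bracelet of weight three is the multiset of its gaps \<open>p, q, r\<close> between consecutive ones,
  with \<open>p + q + r = m = d - 3\<close>, and the trace becomes \<open>1 + y\<^sup>p + y\<^sup>q + y\<^sup>r\<close> when
  \<open>A0\<close> is specialised to \<open>diag(1, y)\<close> and \<open>A1\<close> to the matrix with rows \<open>(1, 1), (1, 0)\<close>. Every
  bracelet in question has the gaps \<open>0, q, m - q\<close> or \<open>1, q, m - 1 - q\<close>. In a linear relation, let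
  \<open>A g\<close> and \<open>B g\<close> be the coefficients of \<open>y\<^sup>g\<close> contributed by the last two gaps in the first and
  second family. They are symmetric under \<open>g \<mapsto> m - g\<close> and \<open>g \<mapsto> m - 1 - g\<close>, and \<open>A g = - B g\<close> for
  \<open>g \<ge> 2\<close>; composing the two reflections gives \<open>B (g + 1) = B g\<close>, so \<open>B\<close> is constant on
  \<open>1..m - 2\<close>. The coefficient of \<open>y\<close> then equals \<open>m / 2\<close> times that constant, which is
  therefore zero.\<close>

section \<open>Independent families\<close>

text \<open>\<open>independent\<close> speaks of a set and would merge equal values of
  \<open>f\<close>. A collision of \<open>f\<close> at two indices is itself a relation with
  coefficients 1 and -1, so it contradicts \<open>indep\<close>.\<close>

lemma (in vector_space) inj_on_independent_imageI:
  assumes fin: "finite B"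
    and indep: "\<And>u. (\<Sum>b\<in>B. scale (u b) (f b)) = 0 \<Longrightarrow> \<forall>b\<in>B. u b = 0"
  shows "inj_on f B \<and> independent (f ` B)"
proof
  show inj: "inj_on f B"
  proof (rule inj_onI, rule ccontr)
    fix x y assume xy: "x \<in> B" "y \<in> B" "f x = f y" "x \<noteq> y"
    define u where "u b = (if b = x then 1 else if b = y then - 1 else 0 :: 'a)" for b
    have "(\<Sum>b\<in>B. scale (u b) (f b)) = (\<Sum>b\<in>{x, y}. scale (u b) (f b))"
      using fin xy by (intro sum.mono_neutral_right) (auto simp: u_def)
    also have "\<dots> = 0"
      using xy by (simp add: u_def)
    finally have "u x = 0"
      using indep xy by blast
    then show False by (simp add: u_def)
  qed
  show "independent (f ` B)"
  proof
    assume "dependent (f ` B)"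
    then obtain u where u: "\<exists>v\<in>f ` B. u v \<noteq> 0" "(\<Sum>v\<in>f ` B. scale (u v) v) = 0"
      using fin by (auto simp: dependent_finite)
    have "(\<Sum>b\<in>B. scale (u (f b)) (f b)) = 0"
      using u(2) inj by (simp add: sum.reindex)
    then have "\<forall>b\<in>B. u (f b) = 0"
      by (rule indep)
    with u(1) show False by auto
  qed
qed


section \<open>Evaluation of polynomials\<close>

instance var :: finite
proof
  have "(UNIV :: var set) = {VA1, VA2, VA3, VA4, VB1, VB2, VB3, VB4}"
    using var.exhaust by auto
  then show "finite (UNIV :: var set)"
    by (metis finite.emptyI finite.insertI)
qed

definition eval_monom :: "('v::finite \<Rightarrow> 'a::comm_ring_1) \<Rightarrow> ('v \<Rightarrow>\<^sub>0 nat) \<Rightarrow> 'a" where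
  "eval_monom f m = (\<Prod>v\<in>UNIV. f v ^ Poly_Mapping.lookup m v)"

definition eval_poly :: "('v::finite \<Rightarrow> 'a::comm_ring_1) \<Rightarrow> (('v \<Rightarrow>\<^sub>0 nat) \<Rightarrow>\<^sub>0 'a) \<Rightarrow> 'a" where
  "eval_poly f p = (\<Sum>m\<in>Poly_Mapping.keys p. Poly_Mapping.lookup p m * eval_monom f m)"

lemma eval_monom_0 [simp]: "eval_monom f 0 = 1"
  by (simp add: eval_monom_def)

lemma eval_monom_add: "eval_monom f (m + n) = eval_monom f m * eval_monom f n"
  by (simp add: eval_monom_def lookup_add power_add prod.distrib)

lemma eval_monom_single [simp]: "eval_monom f (Poly_Mapping.single v 1) = f v"
proof -
  have "eval_monom f (Poly_Mapping.single v 1) = (\<Prod>x\<in>UNIV. if v = x then f x else 1)"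
    unfolding eval_monom_def by (intro prod.cong) (auto simp: lookup_single when_def)
  then show ?thesis by simp
qed

lemma eval_poly_superset:
  assumes "finite S" "Poly_Mapping.keys p \<subseteq> S"
  shows "eval_poly f p = (\<Sum>m\<in>S. Poly_Mapping.lookup p m * eval_monom f m)"
  unfolding eval_poly_def using assms
  by (intro sum.mono_neutral_left) (auto simp: in_keys_iff)

lemma eval_poly_0 [simp]: "eval_poly f 0 = 0"
  by (simp add: eval_poly_def)

lemma eval_poly_single [simp]: "eval_poly f (Poly_Mapping.single m c) = c * eval_monom f m"
  using eval_poly_superset[of "{m}" "Poly_Mapping.single m c" f] by simp

lemma eval_poly_1 [simp]: "eval_poly f 1 = 1"
  using eval_poly_single[of f 0 1] by simp

lemma eval_poly_add [simp]: "eval_poly f (p + q) = eval_poly f p + eval_poly f q"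
proof -
  let ?S = "Poly_Mapping.keys p \<union> Poly_Mapping.keys q"
  show ?thesis
    using keys_add[of p q]
    by (simp add: eval_poly_superset[of ?S] lookup_add distrib_right sum.distrib)
qed

lemma eval_poly_sum: "eval_poly f (sum g A) = (\<Sum>x\<in>A. eval_poly f (g x))"
  by (induction A rule: infinite_finite_induct) auto

lemma poly_mapping_sum_singles:
  "p = (\<Sum>m\<in>Poly_Mapping.keys p. Poly_Mapping.single m (Poly_Mapping.lookup p m))"
  by (rule poly_mapping_eqI) (auto simp: lookup_sum lookup_single when_def in_keys_iff)

text \<open>Expanding both factors into single terms reduces this to multiplicativity on
  monomials.\<close>

lemma eval_poly_mult [simp]: "eval_poly f (p * q) = eval_poly f p * eval_poly f q"
proof -
  have "p * q = (\<Sum>m\<in>Poly_Mapping.keys p. \<Sum>n\<in>Poly_Mapping.keys q.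
      Poly_Mapping.single (m + n) (Poly_Mapping.lookup p m * Poly_Mapping.lookup q n))"
    by (subst poly_mapping_sum_singles[of p], subst poly_mapping_sum_singles[of q])
      (simp add: sum_product mult_single)
  then show ?thesis
    by (simp add: eval_poly_sum eval_poly_def[of f p] eval_poly_def[of f q] sum_product
        eval_monom_add mult_ac)
qed

lemma eval_poly_Var [simp]: "eval_poly f (Var v) = f v"
  by (simp only: Var_def eval_poly_single eval_monom_single mult_1)

lemma eval_poly_scale [simp]: "eval_poly f (mpoly_scale c p) = c * eval_poly f p"
  by (simp add: mpoly_scale_eq)


section \<open>Words of weight three\<close>

text \<open>Read cyclically, the last gap \<open>r\<close> leads back to the initial one, so the
  three gaps play the same role.\<close>

definition gap_word :: "nat \<Rightarrow> nat \<Rightarrow> nat \<Rightarrow> bool list" where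
  "gap_word p q r = True # replicate p False @ True # replicate q False @ True # replicate r False"

lemma length_gap_word [simp]: "length (gap_word p q r) = p + q + r + 3"
  by (simp add: gap_word_def)

lemma dihedral_eq_append_swap: "dihedral_eq (u @ v) (v @ u)"
  using dihedral_eq_rotate[of "u @ v" "length u"] by (simp add: rotate_append)

lemma gap_word_rotate: "dihedral_eq (gap_word p q r) (gap_word q r p)"
  using dihedral_eq_append_swap[of "True # replicate p False"
      "True # replicate q False @ True # replicate r False"]
  by (simp add: gap_word_def)

text \<open>The reversed word ends in the initial one; moving that letter back to the front gives a
  gap word again.\<close>

lemma gap_word_reverse: "dihedral_eq (gap_word p q r) (gap_word r q p)"
proof -
  have "dihedral_eq (gap_word p q r) (rev (gap_word p q r))"
    by (intro dihedral_eq.intros)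
  moreover have "dihedral_eq (rev (gap_word p q r)) (gap_word r q p)"
    using dihedral_eq_append_swap
      [of "replicate r False @ True # replicate q False @ True # replicate p False" "[True]"]
    by (simp add: gap_word_def)
  ultimately show ?thesis using dihedral_eq_trans by blast
qed

lemma gap_word_swap: "dihedral_eq (gap_word p q r) (gap_word p r q)"
  using gap_word_rotate gap_word_reverse dihedral_eq_trans by metis

lemma count_list_True_0: "count_list w True = 0 \<Longrightarrow> w = replicate (length w) False"
  by (induction w) (auto split: if_splits)

lemma count_list_True_1:
  assumes "count_list w True = 1"
  obtains q r where "w = replicate q False @ True # replicate r False"
proof -
  have "True \<in> set w"
    using assms count_list_0_iff[of w True] by fastforce
  then obtain u v where w: "w = u @ True # v"
    by (auto simp: in_set_conv_decomp)
  with assms have "count_list u True = 0" "count_list v True = 0"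
    by auto
  then show thesis
    using that w count_list_True_0 by metis
qed

lemma sublist_dihedral:
  assumes "sublist u w"
  obtains v where "dihedral_eq w (u @ v)"
proof -
  obtain x y where "w = x @ u @ y"
    using assms by (auto simp: sublist_def)
  then show thesis
    using that[of "y @ x"] dihedral_eq_append_swap[of x "u @ y"] by simp
qed

lemma dihedral_eq_gap_word_0:
  assumes "sublist [True, True] w" "count_list w True = 3"
  obtains q r where "dihedral_eq w (gap_word 0 q r)"
proof -
  obtain v where v: "dihedral_eq w ([True, True] @ v)"
    using assms(1) by (rule sublist_dihedral)
  then have "count_list v True = 1"
    using dihedral_eq_count[OF v, of True] assms(2) by simp
  then obtain q r where "v = replicate q False @ True # replicate r False"
    by (rule count_list_True_1)
  then show thesis using that v by (simp add: gap_word_def)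
qed

lemma dihedral_eq_gap_word_1:
  assumes "sublist [True, False, True] w" "count_list w True = 3"
  obtains q r where "dihedral_eq w (gap_word 1 q r)"
proof -
  obtain v where v: "dihedral_eq w ([True, False, True] @ v)"
    using assms(1) by (rule sublist_dihedral)
  then have "count_list v True = 1"
    using dihedral_eq_count[OF v, of True] assms(2) by simp
  then obtain q r where "v = replicate q False @ True # replicate r False"
    by (rule count_list_True_1)
  then show thesis using that v by (simp add: gap_word_def)
qed

text \<open>Normal forms \<open>(p, q)\<close> with third gap \<open>m - p - q\<close>. The bounds
  say that \<open>q\<close> is at most the third gap; \<open>1 \<le> q\<close> in the second family
  keeps gap 0 out of it, so no multiset of gaps occurs twice.\<close>

definition gap_index :: "nat \<Rightarrow> (nat \<times> nat) set" where
  "gap_index m = {0} \<times> {q. 2 * q \<le> m} \<union> {1} \<times> {q. 1 \<le> q \<and> 1 + 2 * q \<le> m}"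

lemma bracelet_eq:
  assumes "b \<in> bracelets d" "b' \<in> bracelets d" "w \<in> b" "w \<in> b'"
  shows "b = b'"
  using quotient_disj[OF equiv_dihedral] assms unfolding bracelets_def by blast

lemma bracelet_dihedral_closed:
  assumes "b \<in> bracelets d" "w \<in> b" "dihedral_eq w v"
  shows "v \<in> b"
proof -
  obtain x where b: "b = {w. x \<in> words d \<and> w \<in> words d \<and> dihedral_eq x w}"
    using assms(1) unfolding bracelets_def by (auto elim!: quotientE)
  have "v \<in> words d"
    using b assms(2) dihedral_eq_length[OF assms(3)] by (simp add: words_def)
  then show ?thesis
    using b assms(2) dihedral_eq_trans[OF assms(3)] by simp
qed

lemma B3_tilde_gap_word:
  assumes "b \<in> B3_tilde d"
  obtains m p q where "d = m + 3" "(p, q) \<in> gap_index m" "gap_word p q (m - p - q) \<in> b"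
proof -
  have b: "b \<in> bracelets d" and wt: "\<And>w. w \<in> b \<Longrightarrow> count_list w True = 3"
    using assms by (auto simp: B3_tilde_def bracelets_of_weight_def)
  have len: "length w = d" if "w \<in> b" for w
    using b that unfolding bracelets_def by (auto elim!: quotientE simp: words_def)
  note closed = bracelet_dihedral_closed[OF b]
  consider q r where "gap_word 0 q r \<in> b" | q r where "gap_word 1 q r \<in> b"
    using assms closed dihedral_eq_gap_word_0 dihedral_eq_gap_word_1 wt
    unfolding B3_tilde_def bracelet_contains_def by (smt (verit) mem_Collect_eq)
  \<comment> \<open>A word of the second kind with a zero gap can be moved by rotation or reversal
    so that this gap comes first.\<close>
  then consider q r where "gap_word 0 q r \<in> b" | q r where "gap_word 1 q r \<in> b" "1 \<le> q" "1 \<le> r"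
  proof cases
    case (2 q r)
    consider "1 \<le> q \<and> 1 \<le> r" | "q = 0" | "r = 0" by linarith
    then show thesis
    proof cases
      case 1 then show thesis using 2 that(2) by blast
    next
      case 2 then show thesis
        using \<open>gap_word 1 q r \<in> b\<close> that(1) closed gap_word_rotate by metis
    next
      case 3 then show thesis
        using \<open>gap_word 1 q r \<in> b\<close> that(1) closed gap_word_reverse by metis
    qed
  qed (use that in blast)
  then obtain p q r where w: "gap_word p q r \<in> b" and p: "p = 0 \<or> p = 1 \<and> 1 \<le> q \<and> 1 \<le> r"
    by (metis One_nat_def)
  define x y where "x = min q r" and "y = max q r"
  have xy: "gap_word p x y \<in> b" "x \<le> y" "p = 0 \<or> p = 1 \<and> 1 \<le> x"
    using w p closed[OF w gap_word_swap] by (auto simp: x_def y_def min_def max_def)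
  show thesis
  proof (rule that[of "p + x + y" p x])
    show "d = p + x + y + 3"
      using len[OF xy(1)] by simp
    show "(p, x) \<in> gap_index (p + x + y)"
      using xy by (auto simp: gap_index_def)
    show "gap_word p x (p + x + y - p - x) \<in> b"
      using xy by simp
  qed
qed

section \<open>Specialisation of the traces to one variable\<close>

fun spec :: "complex \<Rightarrow> var \<Rightarrow> complex" where
  "spec y VA1 = 1" | "spec y VA2 = 0" | "spec y VA3 = 0" | "spec y VA4 = y"
| "spec y VB1 = 1" | "spec y VB2 = 1" | "spec y VB3 = 1" | "spec y VB4 = 0"

definition eval_mat :: "complex \<Rightarrow> mpoly^2^2 \<Rightarrow> complex^2^2" where
  "eval_mat y M = (\<chi> i j. eval_poly (spec y) (M $ i $ j))"

lemma eval_mat_mult: "eval_mat y (M ** N) = eval_mat y M ** eval_mat y N"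
  by (simp add: eval_mat_def matrix_matrix_mult_def vec_eq_iff sum_2)

lemma eval_mat_1: "eval_mat y (mat 1) = mat 1"
  by (simp add: eval_mat_def mat_def vec_eq_iff)

lemma eval_mat_replicate_False:
  "eval_mat y (word_mat (replicate n False)) = vector [vector [1, 0], vector [0, y ^ n]]"
proof (induction n)
  case 0
  show ?case by (simp add: eval_mat_1) (simp add: mat_def vec_eq_iff forall_2)
next
  case (Suc n)
  have "eval_mat y (letter_mat False) = vector [vector [1, 0], vector [0, y]]"
    by (simp add: eval_mat_def letter_mat_def A0_def vec_eq_iff forall_2)
  then show ?case
    by (simp add: eval_mat_mult Suc.IH)
      (simp add: matrix_matrix_mult_def vec_eq_iff forall_2 sum_2)
qed

text \<open>The trace sums over a choice of a diagonal entry, 1 or a power of \<open>y\<close>, for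
  each gap. The zero entry of the specialised \<open>A1\<close> forbids powers of \<open>y\<close>
  at two gaps, any two being cyclically adjacent, which leaves 1 and one power per gap.\<close>

lemma eval_T_gap_word:
  "eval_poly (spec y) (T_word (gap_word p q r)) = 1 + y ^ p + y ^ q + y ^ r"
proof -
  have A1: "eval_mat y (letter_mat True) = vector [vector [1, 1], vector [1, 0]]"
    by (simp add: eval_mat_def letter_mat_def A1_def vec_eq_iff forall_2)
  have "eval_poly (spec y) (T_word w) = trace (eval_mat y (word_mat w))" for w
    by (simp add: T_word_def trace_def eval_mat_def sum_2)
  then show ?thesis
    by (simp add: gap_word_def word_mat_append eval_mat_mult eval_mat_replicate_False A1)
      (simp add: trace_def matrix_matrix_mult_def sum_2)
qed


section \<open>Independence of the gap polynomials\<close>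

text \<open>The coefficient of \<open>y\<^sup>g\<close> in \<open>\<Sum>q\<le>n div 2. c q (y\<^sup>q + y\<^sup>n\<^sup>-\<^sup>q)\<close>.\<close>

definition fold_coeff :: "(nat \<Rightarrow> complex) \<Rightarrow> nat \<Rightarrow> nat \<Rightarrow> complex" where
  "fold_coeff c n g = (\<Sum>q\<le>n div 2. c q * (of_bool (q = g) + of_bool (n - q = g)))"

lemma fold_coeff_reflect:
  assumes "g \<le> n"
  shows "fold_coeff c n (n - g) = fold_coeff c n g"
  unfolding fold_coeff_def using assms
  by (intro sum.cong refl arg_cong2[where f = "(*)"]) auto

text \<open>In the lower half only \<open>q = g\<close> contributes; at the midpoint both indicators
  fire, hence the 2. The factor is never zero, so \<open>fold_coeff\<close> determines
  \<open>c\<close>.\<close>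

lemma fold_coeff_eq:
  assumes "g \<le> n div 2"
  shows "fold_coeff c n g = (if 2 * g = n then 2 else 1) * c g"
proof -
  have "fold_coeff c n g = (\<Sum>q\<le>n div 2. if q = g then (if 2 * g = n then 2 else 1) * c g else 0)"
    unfolding fold_coeff_def using assms by (intro sum.cong) auto
  then show ?thesis using assms by simp
qed

lemma fold_coeff_0:
  assumes "n < g"
  shows "fold_coeff c n g = 0"
  unfolding fold_coeff_def using assms by (intro sum.neutral) auto

lemma sum_fold_coeff: "(\<Sum>g\<le>n. fold_coeff c n g) = 2 * (\<Sum>q\<le>n div 2. c q)"
proof -
  have "(\<Sum>g\<le>n. fold_coeff c n g)
      = (\<Sum>q\<le>n div 2. c q * (\<Sum>g\<le>n. of_bool (q = g) + of_bool (n - q = g)))"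
    unfolding fold_coeff_def by (subst sum.swap) (simp add: sum_distrib_left)
  also have "\<dots> = (\<Sum>q\<le>n div 2. c q * 2)"
    by (intro sum.cong refl arg_cong2[where f = "(*)"]) (auto simp: sum.distrib of_bool_def)
  finally show ?thesis
    by (simp add: sum_distrib_left mult.commute)
qed

text \<open>The equations start at \<open>g = 1\<close> to avoid the constants 1 of all the traces.
  The extra term at \<open>g = 1\<close> comes from the fixed gap 1 of the second family.\<close>

lemma fold_coeff_system:
  assumes m: "1 \<le> m" and c1_0: "c1 0 = 0"
    and eq: "\<And>g. 1 \<le> g \<Longrightarrow> fold_coeff c0 m g + fold_coeff c1 (m - 1) g
      + of_bool (g = 1) * (\<Sum>q\<le>(m - 1) div 2. c1 q) = 0"
  shows "\<forall>q\<le>m div 2. c0 q = 0" and "\<forall>q\<le>(m - 1) div 2. c1 q = 0"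
proof -
  define A B where "A = fold_coeff c0 m" and "B = fold_coeff c1 (m - 1)"
  have A_refl: "A (m - g) = A g" if "g \<le> m" for g
    unfolding A_def using that by (rule fold_coeff_reflect)
  have B_refl: "B (m - 1 - g) = B g" if "g \<le> m - 1" for g
    unfolding B_def using that by (rule fold_coeff_reflect)
  have AB: "A g = - B g" if "2 \<le> g" for g
    using eq[of g] that by (simp add: A_def B_def add_eq_0_iff2)
  have B0: "B 0 = 0"
    using c1_0 by (simp add: B_def fold_coeff_eq)
  then have Bm: "B (m - 1) = 0"
    using B_refl[of 0] by simp
  have B: "B g = 0" if g: "g \<le> m - 1" for g
  proof (cases "m \<le> 2")
    case True
    then have "g = 0 \<or> g = m - 1" using g by linarith
    then show ?thesis using B0 Bm by auto
  next
    case False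
    \<comment> \<open>Here \<open>m - 1 \<ge> 2\<close>, so
      \<open>A 1 = A (m - 1) = - B (m - 1) = 0\<close>.\<close>
    have A1: "A 1 = 0"
      using A_refl[of 1] AB[of "m - 1"] Bm False by simp
    \<comment> \<open>The bounds on \<open>q\<close> make both \<open>q + 1\<close> and
      \<open>m - 1 - q\<close> at least 2, as \<open>AB\<close> requires.\<close>
    have shift: "B (q + 1) = B q" if "1 \<le> q" "q \<le> m - 3" for q
    proof -
      have "B q = B (m - 1 - q)" using B_refl[of q] that False by simp
      also have "\<dots> = - A (m - (q + 1))" using AB[of "m - 1 - q"] that False by simp
      also have "\<dots> = B (q + 1)" using A_refl[of "q + 1"] AB[of "q + 1"] that False by simp
      finally show ?thesis by simp
    qed
    have const: "B q = B 1" if "1 \<le> q" "q \<le> m - 2" for q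
      using that
    proof (induction q rule: dec_induct)
      case (step n)
      then show ?case using shift[of n] by simp
    qed simp
    \<comment> \<open>The total of \<open>B\<close> counts each \<open>c1 q\<close> twice; since
      \<open>B\<close> vanishes at both ends and is constant between, the total is also
      \<open>m - 2\<close> copies of \<open>B 1\<close>.\<close>
    have "2 * (\<Sum>q\<le>(m - 1) div 2. c1 q) = (\<Sum>g\<le>m - 1. B g)"
      by (simp add: B_def sum_fold_coeff)
    also have "\<dots> = (\<Sum>g\<in>{1..m - 2}. B g)"
    proof (intro sum.mono_neutral_right)
      show "\<forall>i\<in>{..m - 1} - {1..m - 2}. B i = 0"
      proof
        fix i assume "i \<in> {..m - 1} - {1..m - 2}"
        then have "i = 0 \<or> i = m - 1" by auto
        then show "B i = 0" using B0 Bm by auto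
      qed
    qed auto
    also have "\<dots> = (\<Sum>g\<in>{1..m - 2}. B 1)"
      by (intro sum.cong refl const) auto
    finally have S: "2 * (\<Sum>q\<le>(m - 1) div 2. c1 q) = of_nat (m - 2) * B 1"
      by simp
    have "B 1 + (\<Sum>q\<le>(m - 1) div 2. c1 q) = 0"
      using eq[of 1] A1 by (simp add: A_def B_def)
    then have "2 * B 1 + of_nat (m - 2) * B 1 = 0"
      unfolding S[symmetric] by (simp flip: distrib_left)
    then have "of_nat (2 + (m - 2)) * B 1 = 0"
      by (simp only: of_nat_add of_nat_numeral distrib_right)
    then have "B 1 = 0"
      using False by (simp only: mult_eq_0_iff of_nat_eq_0_iff) simp
    moreover have "g = 0 \<or> g = m - 1 \<or> 1 \<le> g \<and> g \<le> m - 2" using g by linarith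
    ultimately show ?thesis using B0 Bm const by metis
  qed
  show c1: "\<forall>q\<le>(m - 1) div 2. c1 q = 0"
  proof (intro allI impI)
    fix q assume q: "q \<le> (m - 1) div 2"
    then have "q \<le> m - 1" by linarith
    then show "c1 q = 0"
      using B fold_coeff_eq[OF q, of c1] by (auto simp: B_def split: if_splits)
  qed
  have A: "A g = 0" if "1 \<le> g" for g
  proof -
    have "B g = 0"
      using B fold_coeff_0 by (cases "g \<le> m - 1") (auto simp: B_def)
    then show ?thesis using eq[OF that] c1 by (simp add: A_def B_def)
  qed
  \<comment> \<open>No equation is given at 0; reflection turns \<open>A 0\<close> into
    \<open>A m\<close>, and \<open>m \<ge> 1\<close>.\<close>
  then have A': "A g = 0" for g
    using A_refl[of 0] m by (cases "g = 0") auto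
  show "\<forall>q\<le>m div 2. c0 q = 0"
  proof (intro allI impI)
    fix q assume q: "q \<le> m div 2"
    then show "c0 q = 0"
      using A'[of q] fold_coeff_eq[OF q, of c0] by (auto simp: A_def split: if_splits)
  qed
qed

lemma finite_gap_index: "finite (gap_index m)"
  by (rule finite_subset[of _ "{0, 1} \<times> {..m}"]) (auto simp: gap_index_def)

text \<open>Padding the second family with a zero at \<open>q = 0\<close> gives both sums the index
  range of \<open>fold_coeff\<close>; for \<open>m = 0\<close> the padded sum is just that
  zero.\<close>

lemma sum_gap_index:
  fixes h :: "nat \<times> nat \<Rightarrow> complex"
  shows "sum h (gap_index m) = (\<Sum>q\<le>m div 2. h (0, q))
    + (\<Sum>q\<le>(m - 1) div 2. if q = 0 then 0 else h (1, q))"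
proof -
  have "sum h (gap_index m) = sum h ({0} \<times> {q. 2 * q \<le> m})
      + sum h ({1} \<times> {q. 1 \<le> q \<and> 1 + 2 * q \<le> m})"
    unfolding gap_index_def
    by (intro sum.union_disjoint finite_cartesian_product)
      (auto intro: finite_subset[of _ "{..m}"])
  also have "sum h ({0} \<times> {q. 2 * q \<le> m}) = (\<Sum>q\<le>m div 2. h (0, q))"
    by (intro sum.reindex_bij_witness[of _ "\<lambda>q. (0, q)" snd]) auto
  also have "sum h ({1} \<times> {q. 1 \<le> q \<and> 1 + 2 * q \<le> m})
      = (\<Sum>q\<in>{1..(m - 1) div 2}. h (1, q))"
    by (intro sum.reindex_bij_witness[of _ "\<lambda>q. (1, q)" snd]) auto
  also have "\<dots> = (\<Sum>q\<le>(m - 1) div 2. if q = 0 then 0 else h (1, q))"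
    by (intro sum.mono_neutral_cong_left) auto
  finally show ?thesis .
qed

lemma gap_polys_independent:
  fixes c :: "nat \<times> nat \<Rightarrow> complex"
  assumes zero: "\<And>y. (\<Sum>(p, q)\<in>gap_index m. c (p, q) * (1 + y ^ p + y ^ q + y ^ (m - p - q))) = 0"
    and pq: "(p, q) \<in> gap_index m"
  shows "c (p, q) = 0"
\<comment> \<open>For \<open>m = 0\<close> the only polynomial is the constant 4.\<close>
proof (cases "m = 0")
  case True
  then have "gap_index m = {(0, 0)}" by (auto simp: gap_index_def)
  then show ?thesis using zero[of 0] pq True by simp
next
  case False
  define P where "P = (\<Sum>(p, q)\<in>gap_index m.
    smult (c (p, q)) (1 + monom 1 p + monom 1 q + monom 1 (m - p - q)))"
  have "poly P y = 0" for y
    using zero[of y] by (simp add: P_def poly_sum case_prod_unfold poly_monom)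
  \<comment> \<open>A polynomial vanishing on all of the infinite field is zero, so its coefficients
    can be compared.\<close>
  then have "P = 0"
    using poly_all_0_iff_0 by blast
  define c0 c1 where "c0 q = c (0, q)" and "c1 q = (if q = 0 then 0 else c (1, q))" for q
  have "fold_coeff c0 m g + fold_coeff c1 (m - 1) g
      + of_bool (g = 1) * (\<Sum>q\<le>(m - 1) div 2. c1 q) = 0" if g: "1 \<le> g" for g
  proof -
    have "0 = coeff P g" using \<open>P = 0\<close> by simp
    also have "\<dots> = (\<Sum>(p, q)\<in>gap_index m.
        c (p, q) * (of_bool (p = g) + of_bool (q = g) + of_bool (m - p - q = g)))"
      using g by (simp add: P_def coeff_sum case_prod_unfold of_bool_def)
    also have "\<dots> = (\<Sum>q\<le>m div 2. c0 q * (of_bool (q = g) + of_bool (m - q = g)))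
      + (\<Sum>q\<le>(m - 1) div 2. c1 q * (of_bool (1 = g) + of_bool (q = g) + of_bool (m - 1 - q = g)))"
      unfolding sum_gap_index using g
      by (intro arg_cong2[where f = "(+)"] sum.cong) (auto simp: c0_def c1_def)
    also have "\<dots> = fold_coeff c0 m g + fold_coeff c1 (m - 1) g
      + of_bool (g = 1) * (\<Sum>q\<le>(m - 1) div 2. c1 q)"
      by (simp add: fold_coeff_def distrib_left sum.distrib sum_distrib_left mult.commute eq_commute[of g])
    finally show ?thesis by simp
  qed
  moreover have "1 \<le> m" "c1 0 = 0" using False by (auto simp: c1_def)
  ultimately have "\<forall>q\<le>m div 2. c0 q = 0" "\<forall>q\<le>(m - 1) div 2. c1 q = 0"
    using fold_coeff_system by blast+
  moreover have "p = 0 \<and> q \<le> m div 2 \<or> p = 1 \<and> 1 \<le> q \<and> q \<le> (m - 1) div 2"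
    using pq by (auto simp: gap_index_def)
  ultimately show ?thesis
    by (auto simp: c0_def c1_def)
qed

section \<open>Transfer from gap indices to bracelets\<close>

theorem lemma4p12:
  fixes d :: nat
  assumes "d \<ge> 1"
  shows "inj_on T_bracelet (B3_tilde d) \<and> mpoly.independent (T_bracelet ` B3_tilde d)"
proof -
  \<comment> \<open>Truncation is harmless: any bracelet in \<open>B3_tilde d\<close> forces
    \<open>d \<ge> 3\<close>.\<close>
  define m where "m = d - 3"
  have "\<exists>i. i \<in> gap_index m \<and> gap_word (fst i) (snd i) (m - fst i - snd i) \<in> b"
    if "b \<in> B3_tilde d" for b
    using that by (rule B3_tilde_gap_word) (auto simp: m_def)
  then obtain k where k: "\<And>b. b \<in> B3_tilde d \<Longrightarrow> k b \<in> gap_index m"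
      "\<And>b. b \<in> B3_tilde d \<Longrightarrow> gap_word (fst (k b)) (snd (k b)) (m - fst (k b) - snd (k b)) \<in> b"
    by metis
  have br: "b \<in> bracelets d" if "b \<in> B3_tilde d" for b
    using that by (simp add: B3_tilde_def bracelets_of_weight_def)
  \<comment> \<open>Bracelets with the same index share a gap word, and distinct classes are
    disjoint. This also yields finiteness below.\<close>
  have inj: "inj_on k (B3_tilde d)"
  proof (rule inj_onI)
    fix b b' assume "b \<in> B3_tilde d" "b' \<in> B3_tilde d" "k b = k b'"
    then show "b = b'"
      using bracelet_eq[OF br br k(2)] k(2)[of b'] by simp
  qed
  have sub: "k ` B3_tilde d \<subseteq> gap_index m" using k(1) by blast
  show ?thesis
  proof (rule mpoly.inj_on_independent_imageI)
    show "finite (B3_tilde d)"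
      using inj sub finite_gap_index by (metis finite_imageD finite_subset)
    fix u :: "bool list set \<Rightarrow> complex"
    assume u: "(\<Sum>b\<in>B3_tilde d. mpoly_scale (u b) (T_bracelet b)) = 0"
    \<comment> \<open>The coefficients are carried along \<open>k\<close> and extended by zero,
      turning the relation among traces into one over all of \<open>gap_index m\<close>.\<close>
    define c where "c i = (if i \<in> k ` B3_tilde d then u (the_inv_into (B3_tilde d) k i) else 0)" for i
    have ck: "c (k b) = u b" if "b \<in> B3_tilde d" for b
      using that inj by (simp add: c_def the_inv_into_f_f)
    have zero: "(\<Sum>(p, q)\<in>gap_index m. c (p, q) * (1 + y ^ p + y ^ q + y ^ (m - p - q))) = 0" for y
    proof -
      define h where "h i = 1 + y ^ fst i + y ^ snd i + y ^ (m - fst i - snd i)" for i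
      have "(\<Sum>i\<in>gap_index m. c i * h i) = (\<Sum>i\<in>k ` B3_tilde d. c i * h i)"
        using sub finite_gap_index by (intro sum.mono_neutral_right) (auto simp: c_def)
      also have "\<dots> = (\<Sum>b\<in>B3_tilde d. u b * h (k b))"
        using inj by (simp add: sum.reindex ck)
      also have "\<dots> = (\<Sum>b\<in>B3_tilde d. u b * eval_poly (spec y) (T_bracelet b))"
        using T_bracelet_eq[OF br k(2)] by (intro sum.cong) (auto simp: h_def eval_T_gap_word)
      also have "\<dots> = eval_poly (spec y) (\<Sum>b\<in>B3_tilde d. mpoly_scale (u b) (T_bracelet b))"
        by (simp add: eval_poly_sum)
      finally show ?thesis
        by (simp add: u h_def case_prod_unfold)
    qed
    show "\<forall>b\<in>B3_tilde d. u b = 0"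
    proof
      fix b assume b: "b \<in> B3_tilde d"
      then show "u b = 0"
        using gap_polys_independent[OF zero, of "fst (k b)" "snd (k b)"] k(1)[OF b] ck[OF b] by simp
    qed
  qed
qed

end
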